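(* There exist a freezing cellular automaton $f$ on $\{0,1\}^{\mathbb{Z}^2}$ and real numbers $0<\epsilon_1<\epsilon_2<\epsilon_3<1$ such that $f$ trivializes the Bernoulli measures $\mu_{\epsilon_1}$ and $\mu_{\epsilon_3}$ on $\{0,1\}^{\mathbb{Z}^2}$ but does not trivialize $\mu_{\epsilon_2}$.
   Context: A cellular automaton (CA) on $A^{\mathbb{Z}^d}$ ($A$ a finite alphabet) is a map $f:A^{\mathbb{Z}^d}\to A^{\mathbb{Z}^d}$ for which there are a finite neighborhood $N\subset\mathbb{Z}^d$ and a local rule $F:A^N\to A$ with $f(x)_{\vec v}=F\big((x_{\vec v+\vec n})_{\vec n\in N}\big)$ for all $x\in A^{\mathbb{Z}^d}$ and $\vec v\in\mathbb{Z}^d$. The set $A^{\mathbb{Z}^d}$ carries the prodiscrete topology. On $\{0,1\}^{\mathbb{Z}^2}$ use the cellwise order induced by $0<1$; a CA $f$ is freezing if $x\le f(x)$ for all $x$. For $0\le p\le 1$, $\mu_p$ is the Bernoulli (i.i.d. product) measure on $\{0,1\}^{\mathbb{Z}^2}$ in which each cell is $1$ with probability $p$. For a Borel probability measure $\mu$ on $A^{\mathbb{Z}^d}$ and a CA $f$, put $f(\mu)(X)=\mu(f^{-1}(X))$. Borel probability measures are given the weak-$*$ topology (convergence on cylinder sets). The support $\mathrm{Supp}(\nu)$ is the smallest closed set of full $\nu$-measure. The $\mu$-limit set of $f$ is $\Omega_f^\mu=\overline{\bigcup_{\nu\in\mathcal{F}}\mathrm{Supp}(\nu)}$, where $\mathcal{F}$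 is the set of limit points of the sequence $(f^n(\mu))_{n\in\mathbb{N}}$. We say $f$ trivializes $\mu$ if $|\Omega_f^\mu|=1$. *)

theory Defs
  imports "HOL-Probability.Probability"
begin

text \<open>
  Configurations are functions \<^typ>\<open>'g \<Rightarrow> 'a\<close> from an abelian group of cells to a finite discrete
  alphabet. For \<open>\<int>\<^sup>2\<close> the group is \<^typ>\<open>int \<times> int\<close> with componentwise addition; the binary alphabet is
  \<^typ>\<open>bool\<close>, with \<^term>\<open>False\<close> as 0 and \<^term>\<open>True\<close> as 1. The library topology on functions is the
  product topology, and the library order on functions is the cellwise one.
\<close>

definition cellular_automaton ::
    "(('g::ab_group_add \<Rightarrow> 'a::finite) \<Rightarrow> 'g \<Rightarrow> 'a) \<Rightarrow> bool" where
  "cellular_automaton f \<longleftrightarrow>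
     (\<exists>(N :: 'g set) (F :: ('g \<Rightarrow> 'a) \<Rightarrow> 'a). finite N \<and>
        (\<forall>x v. f x v = F (\<lambda>n\<in>N. x (v + n))))"

definition freezing :: "(('g \<Rightarrow> bool) \<Rightarrow> 'g \<Rightarrow> bool) \<Rightarrow> bool" where
  "freezing f \<longleftrightarrow> (\<forall>x. x \<le> f x)"

definition bernoulli_measure :: "real \<Rightarrow> ('g \<Rightarrow> bool) measure" where
  "bernoulli_measure p = (\<Pi>\<^sub>M v\<in>UNIV. measure_pmf (bernoulli_pmf p))"

definition borel_probs :: "'x::topological_space measure set" where
  "borel_probs = {\<nu>. prob_space \<nu> \<and> sets \<nu> = sets borel}"

definition cylinders :: "('g \<Rightarrow> 'a) set set" where
  "cylinders = {{x. \<forall>v\<in>V. x v = w v} | V w. finite V}"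

text \<open>
  The weak-* topology: the coarsest topology on Borel probability measures for which the measure of
  every cylinder set is continuous.
\<close>

definition weak_star :: "('g \<Rightarrow> 'a::{finite,discrete_topology}) measure topology" where
  "weak_star = pullback_topology borel_probs (\<lambda>\<nu>. restrict (measure \<nu>) cylinders)
                 (product_topology (\<lambda>C. euclideanreal) cylinders)"

lemma limitin_weak_star:
  fixes m :: "nat \<Rightarrow> ('g \<Rightarrow> 'a::{finite,discrete_topology}) measure"
  assumes m: "\<And>n. m n \<in> borel_probs"
  shows "limitin weak_star m \<nu> sequentially \<longleftrightarrow>
           \<nu> \<in> borel_probs \<and>
           (\<forall>C\<in>cylinders. (\<lambda>n. measure (m n) C) \<longlonglongrightarrow> measure \<nu> C)" (is "?L \<longleftrightarrow> ?R")
proof -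
  let ?T = "product_topology (\<lambda>C::('g \<Rightarrow> 'a) set. euclideanreal) cylinders"
  let ?f = "\<lambda>\<nu>::('g \<Rightarrow> 'a) measure. restrict (measure \<nu>) cylinders"
  have "?L \<longleftrightarrow> \<nu> \<in> borel_probs \<and> limitin ?T (\<lambda>n. ?f (m n)) (?f \<nu>) sequentially"
    unfolding limitin_def weak_star_def openin_pullback_topology topspace_pullback_topology
    using m by (auto 0 3 elim!: eventually_mono)
  also have "\<dots> \<longleftrightarrow> ?R"
    by (auto simp: limitin_componentwise)
  finally show ?thesis .
qed

text \<open>Limit points of a sequence of measures; the weak-* topology over a countable group is
  metrizable, so these are the limits of subsequences.\<close>

definition limit_measures ::
    "(nat \<Rightarrow> ('g \<Rightarrow> 'a::{finite,discrete_topology}) measure) \<Rightarrow> ('g \<Rightarrow> 'a) measure set" where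
  "limit_measures m = {\<nu>. \<exists>r. strict_mono r \<and> limitin weak_star (m \<circ> r) \<nu> sequentially}"

definition Supp :: "'x::topological_space measure \<Rightarrow> 'x set" where
  "Supp \<nu> = \<Inter>{C. closed C \<and> measure \<nu> C = 1}"

definition mu_limit_set ::
    "(('g \<Rightarrow> 'a::{finite,discrete_topology}) \<Rightarrow> 'g \<Rightarrow> 'a) \<Rightarrow> ('g \<Rightarrow> 'a) measure \<Rightarrow> ('g \<Rightarrow> 'a) set"
  where
  "mu_limit_set f \<mu> = closure (\<Union>\<nu>\<in>limit_measures (\<lambda>n. distr \<mu> borel (f ^^ n)). Supp \<nu>)"

definition trivializes ::
    "(('g \<Rightarrow> 'a::{finite,discrete_topology}) \<Rightarrow> 'g \<Rightarrow> 'a) \<Rightarrow> ('g \<Rightarrow> 'a) measure \<Rightarrow> bool" where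
  "trivializes f \<mu> \<longleftrightarrow> card (mu_limit_set f \<mu>) = 1"

instance bool :: second_countable_topology
proof
  show "\<exists>B::bool set set. countable B \<and> open = generate_topology B"
    by (intro exI[of _ "range (\<lambda>a. {..<a}) \<union> range (\<lambda>a. {a<..})"])
       (auto simp: open_bool_def)
qed

lemma bernoulli_measure_borel_probs:
  "(bernoulli_measure p :: ('g::countable \<Rightarrow> bool) measure) \<in> borel_probs"
proof -
  have "sets (borel :: bool measure) = UNIV"
    using borel_open[OF discrete_topology_class.open_discrete] by blast
  then have "sets (bernoulli_measure p :: ('g \<Rightarrow> bool) measure) = sets (\<Pi>\<^sub>M v\<in>UNIV. borel)"
    unfolding bernoulli_measure_def by (intro sets_PiM_cong) auto
  moreover have "prob_space (bernoulli_measure p :: ('g \<Rightarrow> bool) measure)"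
    unfolding bernoulli_measure_def by (intro prob_space_PiM prob_space_measure_pmf)
  ultimately show ?thesis
    by (simp add: borel_probs_def sets_PiM_equal_borel)
qed

lemma cellular_automaton_continuous:
  fixes f :: "('g::ab_group_add \<Rightarrow> 'a::{finite,discrete_topology}) \<Rightarrow> 'g \<Rightarrow> 'a"
  assumes "cellular_automaton f"
  shows "continuous_on UNIV f"
proof (rule continuous_on_coordinatewise_then_product)
  fix v
  obtain N F where N: "finite N" and F: "\<And>x v. f x v = F (\<lambda>n\<in>N. x (v + n))"
    using assms unfolding cellular_automaton_def by blast
  have "open ((\<lambda>x. f x v) -` B)" for B
  proof (subst open_subopen, intro ballI)
    fix x assume x: "x \<in> (\<lambda>x. f x v) -` B"
    let ?U = "\<Inter>n\<in>N. (\<lambda>y::'g \<Rightarrow> 'a. y (v + n)) -` {x (v + n)}"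
    have "open ?U"
      by (intro open_INT N ballI open_vimage continuous_on_product_coordinates) (rule discrete_topology_class.open_discrete)
    moreover have "y \<in> (\<lambda>x. f x v) -` B" if "y \<in> ?U" for y
    proof -
      have "(\<lambda>n\<in>N. y (v + n)) = (\<lambda>n\<in>N. x (v + n))"
        using that by (auto simp: restrict_def)
      then show ?thesis using x F[of y v] F[of x v] by simp
    qed
    ultimately show "\<exists>T. open T \<and> x \<in> T \<and> T \<subseteq> (\<lambda>x. f x v) -` B"
      by (intro exI[of _ ?U]) auto
  qed
  then show "continuous_on UNIV (\<lambda>x. f x v)"
    by (simp add: continuous_on_open_vimage)
qed

text \<open>\<^const>\<open>Supp\<close> is itself a closed set of full measure, hence the smallest one.\<close>

lemma Supp_closed_full:
  fixes \<nu> :: "'x::second_countable_topology measure"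
  assumes "\<nu> \<in> borel_probs"
  shows "closed (Supp \<nu>)" and "measure \<nu> (Supp \<nu>) = 1"
proof -
  interpret prob_space \<nu> using assms by (simp add: borel_probs_def)
  have s: "sets \<nu> = sets borel" using assms by (simp add: borel_probs_def)
  then have sp: "space \<nu> = UNIV" using sets_eq_imp_space_eq by force
  show "closed (Supp \<nu>)"
    unfolding Supp_def by auto
  let ?O = "uminus ` {C. closed C \<and> measure \<nu> C = 1}"
  obtain O' where O': "O' \<subseteq> ?O" "countable O'" "\<Union>O' = \<Union>?O"
    using Lindelof[of ?O] by (auto simp: open_Compl)
  have null: "U \<in> null_sets \<nu>" if U: "U \<in> O'" for U
  proof -
    obtain C where C: "U = - C" "closed C" "measure \<nu> C = 1" using O'(1) U by auto
    have "C \<in> sets \<nu>" using C(2) s by auto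
    then have "measure \<nu> U = 0"
      using prob_compl[of C] C sp by (simp add: Compl_eq_Diff_UNIV)
    moreover have "U \<in> sets \<nu>" using C s by (auto intro!: borel_open simp: open_Compl)
    ultimately show ?thesis by (auto simp: null_sets_def emeasure_eq_measure)
  qed
  have "(\<Union>U\<in>O'. U) \<in> null_sets \<nu>"
    using O'(2) null by (intro null_sets_UN') auto
  then have "\<Union>O' \<in> null_sets \<nu>" by simp
  moreover have "Supp \<nu> = - \<Union>O'" unfolding O'(3) Supp_def by auto
  ultimately show "measure \<nu> (Supp \<nu>) = 1"
    using prob_compl[of "\<Union>O'"] sp
    by (simp add: Compl_eq_Diff_UNIV null_sets_def measure_def)
qed

end

theory Submission
  imports Defs
begin

text \<open>
  Call a zero with a 1 directly above it a link. In the automaton \<open>link_rule\<close> a zero survives a step iff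
  it is a link and one of the 81 nearby cells of the next column is a zero. Unrolling this in time, a
  cell is still 0 at time \<open>n\<close> only if a chain of \<open>n\<close> links, one per column, starts there in the
  initial configuration (\<open>unfilled_imp_chain\<close>), and it is 0 at time \<open>n\<close> whenever there is such a chain
  of \<open>n + 1\<close> links (\<open>chain_imp_unfilled\<close>). So the question is whether links percolate.

  A link needs a 0 and a 1, and therefore links are scarce both when the density \<open>p\<close> is close to 0 and
  when it is close to 1. At \<open>p = 1/100\<close> and \<open>p = 99/100\<close> the expected number of chains of length \<open>n\<close>
  is at most \<open>(81/100) ^ n\<close>, so every cell turns 1 almost surely (\<open>measure_unfilled_tendsto_0\<close>),
  and the iterates converge to the point mass at the all-one configuration.

  At \<open>p = 1/2\<close> a column segment of 20 cells almost always contains a link, and links in neighbouring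
  segments of consecutive columns support each other. It remains to find, with probability bounded
  away from 0, long directed paths of good segments from a fixed start. This is done by
  renormalization. A coarse site, made of 17 by 3 sites, is declared good if at most one of them is bad.
  The defect can be bypassed, so that paths on the coarse grid refine to paths on the fine grid
  (\<open>refine_path\<close>), while the probability of being bad is squared up to a constant factor
  (\<open>measure_multiscale_bad\<close>). As these probabilities have a small sum, the start is good at all scales
  at once with probability at least \<open>1/2\<close>, and then the chain is as long as desired. Some cell of the
  first segment is therefore 0 with probability at least \<open>1/2\<close> at every time, while each of its cells
  is 1 with probability at least \<open>1/2\<close>. This excludes a one-point limit set (\<open>not_trivializesI\<close>).
\<close>

section \<open>Bernoulli measures\<close>

definition determined_by :: "('g \<Rightarrow> 'a) set \<Rightarrow> 'g set \<Rightarrow> bool" where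
  "determined_by E S \<longleftrightarrow> (\<forall>x y. (\<forall>v\<in>S. x v = y v) \<longrightarrow> x \<in> E \<longrightarrow> y \<in> E)"

lemma determined_byD:
  "determined_by E S \<Longrightarrow> (\<And>v. v \<in> S \<Longrightarrow> x v = y v) \<Longrightarrow> x \<in> E \<longleftrightarrow> y \<in> E"
  unfolding determined_by_def by metis

context
  fixes p :: real
begin

interpretation prob_space "bernoulli_measure p :: ('g::countable \<Rightarrow> bool) measure"
  using bernoulli_measure_borel_probs by (auto simp: borel_probs_def)

lemma sets_bernoulli [measurable_cong]:
  "sets (bernoulli_measure p :: ('g::countable \<Rightarrow> bool) measure) = sets borel"
  using bernoulli_measure_borel_probs by (auto simp: borel_probs_def)

lemma space_bernoulli: "space (bernoulli_measure p :: ('g::countable \<Rightarrow> bool) measure) = UNIV"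
  using sets_eq_imp_space_eq[OF sets_bernoulli] by simp

lemma bernoulli_cylinder:
  fixes w :: "'g::countable \<Rightarrow> bool"
  assumes "finite V"
  shows "measure (bernoulli_measure p) {x. \<forall>v\<in>V. x v = w v} = (\<Prod>v\<in>V. pmf (bernoulli_pmf p) (w v))"
proof -
  interpret product_prob_space "\<lambda>_::'g. measure_pmf (bernoulli_pmf p)" UNIV
    by unfold_locales
  have "{x. \<forall>v\<in>V. x v = w v} = prod_emb UNIV (\<lambda>_. measure_pmf (bernoulli_pmf p)) V (\<Pi>\<^sub>E v\<in>V. {w v})"
    by (auto simp: prod_emb_def PiE_iff space_PiM restrict_def extensional_def)
  then show ?thesis
    using measure_PiM_emb[of V "\<lambda>v. {w v}"] assms
    by (simp add: bernoulli_measure_def measure_pmf_single)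
qed

lemma bernoulli_cell:
  "measure (bernoulli_measure p :: ('g::countable \<Rightarrow> bool) measure) {x. x v = c}
     = pmf (bernoulli_pmf p) c"
  using bernoulli_cylinder[of "{v}" "\<lambda>_. c"] by simp

text \<open>
  The restrictions of a configuration to two disjoint sets of cells are independent random variables.
  An event determined by \<open>S\<close> is recovered from the restriction to \<open>S\<close> by filling the other cells
  with zeros.
\<close>

lemma bernoulli_independent:
  fixes A B :: "('g::countable \<Rightarrow> bool) set"
  assumes "determined_by A S" "determined_by B T" "S \<inter> T = {}"
    and A [measurable]: "A \<in> sets borel" and B [measurable]: "B \<in> sets borel"
  shows "measure (bernoulli_measure p) (A \<inter> B)
           = measure (bernoulli_measure p) A * measure (bernoulli_measure p) B"
proof -
  let ?M = "bernoulli_measure p :: ('g \<Rightarrow> bool) measure"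
  let ?b = "\<lambda>_::'g. measure_pmf (bernoulli_pmf p)"
  interpret P: product_prob_space ?b UNIV
    by unfold_locales
  have M: "?M = PiM UNIV ?b" by (simp add: bernoulli_measure_def)
  have coord: "(\<lambda>x. x v) \<in> measurable ?M (?b v)" for v
    unfolding M by (rule measurable_component_singleton) simp
  have "distr ?M (?b v) (\<lambda>x. x v) = ?b v" for v
    unfolding M by (rule P.PiM_component) simp
  then have "indep_vars ?b (\<lambda>v x. x v) UNIV"
    using coord by (subst indep_vars_iff_distr_eq_PiM) (simp_all add: M distr_id2 restrict_UNIV)
  then have ind: "indep_var (PiM S ?b) (\<lambda>x. restrict x S) (PiM T ?b) (\<lambda>x. restrict x T)"
    using indep_var_restrict[of ?b "\<lambda>v x. x v" UNIV S T] assms(3) by simp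
  have ext: "(\<lambda>y v. if v \<in> R then y v else False) \<in> measurable (PiM R ?b) ?M" for R
    unfolding M
  proof (rule measurable_PiM_single')
    fix v show "(\<lambda>y. if v \<in> R then y v else False) \<in> measurable (PiM R ?b) (?b v)"
      by (cases "v \<in> R") auto
  qed (auto simp: space_PiM)
  let ?E = "\<lambda>R y v. if v \<in> R then y v else False"
  have pre: "?E R -` C \<inter> space (PiM R ?b) \<in> sets (PiM R ?b)" if "C \<in> sets borel" for R C
    using measurable_sets[OF ext, of C R] that by (simp add: sets_bernoulli)
  have eq: "(\<lambda>x. restrict x R) -` (?E R -` C \<inter> space (PiM R ?b)) \<inter> space ?M = C"
    if C: "determined_by C R" for R and C :: "('g \<Rightarrow> bool) set"
  proof -
    have "?E R (restrict x R) \<in> C \<longleftrightarrow> x \<in> C" for x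
      by (rule determined_byD[OF C]) simp
    then show ?thesis by (simp add: set_eq_iff space_PiM space_bernoulli)
  qed
  have "(\<lambda>x. (restrict x S, restrict x T)) -` (X \<times> Y) \<inter> space ?M
      = ((\<lambda>x. restrict x S) -` X \<inter> space ?M) \<inter> ((\<lambda>x. restrict x T) -` Y \<inter> space ?M)" for X Y
    by auto
  then show ?thesis
    using indep_varD[OF ind pre[OF A, of S] pre[OF B, of T]]
    by (simp only: eq[OF assms(1)] eq[OF assms(2)])
qed

end

section \<open>The automaton and its chains of links\<close>

type_synonym config = "int \<times> int \<Rightarrow> bool"

text \<open>
  A zero survives a step iff the cell above it is 1 and the zero is supported by some zero in the next
  column, at most 40 rows away. The reach is twice the length of the blocks of 20 cells used at density
  \<open>1/2\<close>, so that it covers the distance between any two cells in blocks of adjacent rows.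
\<close>

definition link_rule :: "config \<Rightarrow> config" where
  "link_rule x v \<longleftrightarrow> x v \<or> \<not> x (v + (0, 1)) \<or> (\<forall>j\<in>{-40..40}. x (v + (1, j)))"

lemma cellular_automaton_link_rule: "cellular_automaton link_rule"
proof -
  let ?N = "{(0, 0), (0, 1)} \<union> Pair 1 ` {-40..40} :: (int \<times> int) set"
  let ?F = "\<lambda>y. y (0, 0) \<or> \<not> y (0, 1) \<or> (\<forall>j\<in>{-40..40}. y (1, j)) :: bool"
  have "link_rule x v = ?F (\<lambda>n\<in>?N. x (v + n))" for x v
    by (cases v) (auto simp: link_rule_def)
  then show ?thesis
    unfolding cellular_automaton_def by (intro exI[of _ ?N] exI[of _ ?F]) simp
qed

lemma freezing_link_rule: "freezing link_rule"
  by (auto simp: freezing_def link_rule_def)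

lemma funpow_Suc_link_rule:
  "(link_rule ^^ Suc n) x v \<longleftrightarrow> (link_rule ^^ n) x v \<or> \<not> (link_rule ^^ n) x (v + (0, 1)) \<or>
     (\<forall>j\<in>{-40..40}. (link_rule ^^ n) x (v + (1, j)))"
  by (simp add: link_rule_def[of "(link_rule ^^ n) x"])

lemma funpow_link_rule_mono:
  assumes "m \<le> n" "(link_rule ^^ m) x v"
  shows "(link_rule ^^ n) x v"
  using assms by (induction n rule: dec_induct) (auto simp only: funpow_Suc_link_rule)

fun chain :: "(config \<Rightarrow> int \<times> int \<Rightarrow> bool) \<Rightarrow> nat \<Rightarrow> int \<times> int \<Rightarrow> config \<Rightarrow> bool" where
  "chain a 0 v x \<longleftrightarrow> True"
| "chain a (Suc n) v x \<longleftrightarrow> a x v \<and> (\<exists>j\<in>{-40..40}. chain a n (v + (1, j)) x)"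

definition link :: "config \<Rightarrow> int \<times> int \<Rightarrow> bool" where
  "link x v \<longleftrightarrow> \<not> x v \<and> x (v + (0, 1))"

text \<open>
  A cell that is still 0 after \<open>n\<close> steps has a supporting zero at time \<open>n - 1\<close>, which has one at time
  \<open>n - 2\<close>, and so on. All cells of this chain but the last have survived the first step, so they were
  links in the initial configuration: a zero below a 1.
\<close>

lemma unfilled_imp_chain: "\<not> (link_rule ^^ n) x v \<Longrightarrow> chain link n v x"
proof (induction n arbitrary: v)
  case (Suc n)
  from Suc.prems have "\<not> (link_rule ^^ n) x v"
    and "\<exists>j\<in>{-40..40}. \<not> (link_rule ^^ n) x (v + (1, j))"
    by (simp_all only: funpow_Suc_link_rule) blast+
  moreover have "link x v"
    using Suc.prems funpow_link_rule_mono[of "Suc 0" "Suc n" x v] funpow_Suc_link_rule[of 0 x v]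
    by (auto simp: link_def)
  ultimately show ?case using Suc.IH by (subst chain.simps) blast
qed simp

text \<open>
  The end of a chain of links may lose its support at once, but then the filling travels along the
  chain only one link per step. The ones above the links never disappear.
\<close>

lemma chain_imp_unfilled: "chain link (Suc n) v x \<Longrightarrow> \<not> (link_rule ^^ n) x v"
proof (induction n arbitrary: v)
  case 0
  then show ?case by (simp add: link_def)
next
  case (Suc n)
  then obtain j where v: "link x v" and j: "j \<in> {-40..40}" "chain link (Suc n) (v + (1, j)) x"
    by (subst (asm) chain.simps) blast
  have shorten: "chain link (Suc n) v x" if "chain link (Suc (Suc n)) v x" for n v
    using that
  proof (induction n arbitrary: v)
    case (Suc n)
    then show ?case by (subst chain.simps, subst (asm) (2) chain.simps) blast
  qed auto
  have "\<not> (link_rule ^^ n) x v" using Suc.IH[OF shorten[OF Suc.prems]] .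
  moreover have "(link_rule ^^ n) x (v + (0, 1))"
    using funpow_link_rule_mono[of 0 n x] v by (simp add: link_def)
  ultimately show ?case
    using Suc.IH[OF j(2)] j(1) funpow_Suc_link_rule by blast
qed

lemma chain_mono:
  assumes "chain a n v x" "\<And>v. a x v \<Longrightarrow> b x v"
  shows "chain b n v x"
  using assms(1)
proof (induction n arbitrary: v)
  case (Suc n)
  then show ?case using assms(2) by (subst chain.simps, subst (asm) (2) chain.simps) blast
qed simp

lemma cell_value_measurable [measurable]: "Measurable.pred borel (\<lambda>x :: 'g \<Rightarrow> bool. x v)"
proof -
  have "open {x :: 'g \<Rightarrow> bool. x v}"
    using open_vimage[OF discrete_topology_class.open_discrete[of "{True}"]
        continuous_on_product_coordinates[of v]] by (simp add: vimage_def)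
  then show ?thesis by (simp add: pred_def)
qed

lemma chain_measurable [measurable]:
  assumes [measurable]: "\<And>v. Measurable.pred borel (\<lambda>x. a x v)"
  shows "Measurable.pred borel (\<lambda>x. chain a n v x)"
proof (induction n arbitrary: v)
  case 0
  show ?case by (subst chain.simps) measurable
next
  case (Suc n)
  note [measurable] = Suc.IH
  show ?case by (subst chain.simps) measurable
qed

text \<open>
  Chains move one column to the right with each step. This is what makes the first link independent
  of the rest of the chain.
\<close>

lemma chain_determined:
  assumes a: "\<And>v. determined_by {x. a x v} {u. fst u = fst v}"
  shows "determined_by {x. chain a n v x} {u. fst v \<le> fst u}"
proof (induction n arbitrary: v)
  case (Suc n)
  show ?case
    unfolding determined_by_def
  proof (intro allI impI)
    fix x y :: config
    assume eq: "\<forall>u\<in>{u. fst v \<le> fst u}. x u = y u" and x: "x \<in> {x. chain a (Suc n) v x}"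
    then obtain j where j: "j \<in> {-40..40}" "chain a n (v + (1, j)) x" "a x v" by auto
    have "a y v" using determined_byD[OF a, of v x y] eq j(3) by simp
    moreover have "chain a n (v + (1, j)) y"
      using determined_byD[OF Suc.IH, of "v + (1, j)" x y] eq j(2) by simp
    ultimately show "y \<in> {x. chain a (Suc n) v x}" using j(1) by auto
  qed
qed (simp add: determined_by_def)

text \<open>
  Union bound over the 81 choices for each of the \<open>n\<close> steps; the \<open>n\<close> conditions along one chain are
  independent as they concern different columns.
\<close>

lemma measure_chain_le:
  assumes meas [measurable]: "\<And>v. Measurable.pred borel (\<lambda>x. a x v)"
    and det: "\<And>v. determined_by {x. a x v} {u. fst u = fst v}"
    and q: "\<And>v. measure (bernoulli_measure p) {x. a x v} \<le> q"
  shows "measure (bernoulli_measure p) {x. chain a n v x} \<le> (81 * q) ^ n"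
proof (induction n arbitrary: v)
  let ?M = "bernoulli_measure p :: config measure"
  interpret prob_space ?M
    using bernoulli_measure_borel_probs by (auto simp: borel_probs_def)
  have "0 \<le> measure ?M {x. a x v}" by simp
  then have q0: "0 \<le> q" using q[of v] by linarith
  {
    case 0
    show ?case by simp
  next
    case (Suc n)
    let ?B = "\<lambda>j. {x. chain a n (v + (1, j)) x}"
    have B [measurable]: "?B j \<in> sets borel" for j by measurable
    have "determined_by (\<Union>j\<in>{-40..40}. ?B j) {u. fst v + 1 \<le> fst u}"
      unfolding determined_by_def
    proof (intro allI impI)
      fix x y :: config
      assume eq: "\<forall>u\<in>{u. fst v + 1 \<le> fst u}. x u = y u" and "x \<in> (\<Union>j\<in>{-40..40}. ?B j)"
      then obtain j where "j \<in> {-40..40}" "x \<in> ?B j" by auto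
      moreover from this have "y \<in> ?B j"
        using determined_byD[OF chain_determined[OF det], of "v + (1, j)" x y n] eq by simp
      ultimately show "y \<in> (\<Union>j\<in>{-40..40}. ?B j)" by blast
    qed
    then have "measure ?M ({x. a x v} \<inter> (\<Union>j\<in>{-40..40}. ?B j))
        = measure ?M {x. a x v} * measure ?M (\<Union>j\<in>{-40..40}. ?B j)"
      by (intro bernoulli_independent[OF det]) auto
    also have "\<dots> \<le> q * (\<Sum>j\<in>{-40..40}. measure ?M (?B j))"
      by (intro mult_mono q measure_UNION_le q0) (auto simp: sets_bernoulli)
    also have "\<dots> \<le> q * (\<Sum>j\<in>{-40..40::int}. (81 * q) ^ n)"
      by (intro mult_left_mono sum_mono Suc.IH q0)
    also have "\<dots> = (81 * q) ^ Suc n" by simp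
    also have "{x. a x v} \<inter> (\<Union>j\<in>{-40..40}. ?B j) = {x. chain a (Suc n) v x}" by auto
    finally show ?case .
  }
qed

text \<open>
  A link contains both a 0 and a 1. At low density the scarce symbol is the 1 above the link
  (\<open>h = 1\<close>), at high density the link's own 0 (\<open>h = 0\<close>). Either has probability at most \<open>1/100\<close>,
  and \<open>81/100 < 1\<close>.
\<close>

lemma measure_unfilled_tendsto_0:
  assumes "0 \<le> p" "p \<le> 1/100 \<or> 99/100 \<le> p" "p \<le> 1"
  shows "(\<lambda>n. measure (bernoulli_measure p) {x. \<not> (link_rule ^^ n) x v}) \<longlonglongrightarrow> 0"
proof -
  let ?M = "bernoulli_measure p :: config measure"
  interpret prob_space ?M
    using bernoulli_measure_borel_probs by (auto simp: borel_probs_def)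
  define c where "c = (p < 1/2)"
  define h where "h = (if c then 1 else 0 :: int)"
  define a :: "config \<Rightarrow> int \<times> int \<Rightarrow> bool" where "a x v \<longleftrightarrow> x (v + (0, h)) = c" for x v
  have [measurable]: "Measurable.pred borel (\<lambda>x. a x v)" for v unfolding a_def by measurable
  have "measure ?M {x. a x v} \<le> 1/100" for v
    unfolding a_def bernoulli_cell using assms by (auto simp: c_def)
  then have bound: "measure ?M {x. chain a n v x} \<le> (81 * (1/100)) ^ n" for n
    by (intro measure_chain_le) (auto simp: a_def determined_by_def)
  have link_a: "a x u" if "link x u" for x u
    using that by (cases u) (auto simp: link_def a_def h_def)
  have "measure ?M {x. \<not> (link_rule ^^ n) x v} \<le> (81/100) ^ n" for n
  proof -
    have "chain a n v x" if "\<not> (link_rule ^^ n) x v" for x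
      using unfilled_imp_chain[OF that] link_a by (rule chain_mono)
    then have "measure ?M {x. \<not> (link_rule ^^ n) x v} \<le> measure ?M {x. chain a n v x}"
      by (intro finite_measure_mono) (auto simp: sets_bernoulli)
    then show ?thesis using bound[of n] by simp
  qed
  then have "\<forall>\<^sub>F n in sequentially.
      measure ?M {x. \<not> (link_rule ^^ n) x v} \<le> (81/100) ^ n" by simp
  moreover have "(\<lambda>n. (81/100 :: real) ^ n) \<longlonglongrightarrow> 0"
    by (intro LIMSEQ_realpow_zero) auto
  ultimately show ?thesis
    by (rule tendsto_sandwich[OF _ _ tendsto_const, rotated]) simp
qed

section \<open>Refining paths through good sites\<close>

text \<open>
  Sites \<open>(t, i)\<close> form a grid with columns \<open>t\<close> and rows \<open>i\<close>. A coarse site stands for a rectangle of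
  17 columns and 3 rows. Three rows are needed so that two adjacent rectangles with one defect each
  share a row that is intact on both sides of their common edge; 17 columns leave room for three
  disjoint windows of 5 columns between the first and the last column.
\<close>

definition span_cols :: "nat \<Rightarrow> nat set" where "span_cols T = {17 * T..<17 * T + 17}"
definition span_rows :: "int \<Rightarrow> int set" where "span_rows I = {3 * I..<3 * I + 3}"

text \<open>
  A coarse site is good if its rectangle contains at most one bad site. Two defects are needed to
  spoil it, so passing to the coarse grid squares the probability of being bad.
\<close>

definition coarsen :: "(nat \<Rightarrow> int \<Rightarrow> bool) \<Rightarrow> nat \<Rightarrow> int \<Rightarrow> bool" where
  "coarsen g T I \<longleftrightarrow>
     (\<forall>c\<in>span_cols T. \<forall>i\<in>span_rows I. \<forall>c'\<in>span_cols T. \<forall>i'\<in>span_rows I.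
        \<not> g c i \<longrightarrow> \<not> g c' i' \<longrightarrow> c = c' \<and> i = i')"

text \<open>
  Both the current and the next row have to be good in the column that is being left. On the coarse
  grid this means that a path changes rows through two good rectangles lying on top of each other,
  so that the change of row can be carried out inside them on the finer grid.
\<close>

definition good_path :: "(nat \<Rightarrow> int \<Rightarrow> bool) \<Rightarrow> nat \<Rightarrow> (nat \<Rightarrow> int) \<Rightarrow> bool" where
  "good_path g n u \<longleftrightarrow>
     (\<forall>t<n. \<bar>u (Suc t) - u t\<bar> \<le> 1 \<and> g t (u t) \<and> g t (u (Suc t))) \<and> g n (u n)"

lemma coarsenD:
  assumes "coarsen g T I" "c \<in> span_cols T" "i \<in> span_rows I" "\<not> g c i"
    "c' \<in> span_cols T" "i' \<in> span_rows I" "(c', i') \<noteq> (c, i)"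
  shows "g c' i'"
  using assms unfolding coarsen_def by blast

text \<open>
  If the row of \<open>e\<close> contains the defect, then each neighbouring row of the rectangle is intact.
\<close>

lemma clean_row_nearby:
  assumes G: "coarsen g T I" and e: "e \<in> span_rows I" and c0: "c0 \<in> span_cols T" and g: "g c0 e"
  obtains r where "r \<in> span_rows I" "\<bar>r - e\<bar> \<le> 1" "\<And>c. c \<in> span_cols T \<Longrightarrow> g c r"
proof (cases "\<forall>c\<in>span_cols T. g c e")
  case True
  then show ?thesis using e that[of e] by auto
next
  case False
  then obtain c where c: "c \<in> span_cols T" "\<not> g c e" by blast
  obtain r where r: "r \<in> span_rows I" "\<bar>r - e\<bar> \<le> 1" "r \<noteq> e"
  proof (cases "e = 3 * I")
    case True then show ?thesis using that[of "e + 1"] by (auto simp: span_rows_def)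
  next
    case False then show ?thesis using that[of "e - 1"] e by (auto simp: span_rows_def)
  qed
  have "g c' r" if "c' \<in> span_cols T" for c'
    using coarsenD[OF G c(1) e c(2) that r(1)] r(3) by blast
  then show ?thesis using that r by blast
qed

lemma common_good_row:
  assumes G: "coarsen g T I" "coarsen g (Suc T) I"
  obtains e where "e \<in> span_rows I" "g (17 * T + 16) e" "g (17 * T + 17) e"
proof -
  let ?c = "17 * T + 16" let ?d = "17 * T + 17"
  have c: "?c \<in> span_cols T" "?d \<in> span_cols (Suc T)" by (auto simp: span_cols_def)
  have r: "3 * I \<in> span_rows I" "3 * I + 1 \<in> span_rows I" "3 * I + 2 \<in> span_rows I"
    by (auto simp: span_rows_def)
  note C = coarsenD[OF G(1) c(1) _ _ c(1)] and D = coarsenD[OF G(2) c(2) _ _ c(2)]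
  have "g ?c (3*I) \<and> g ?c (3*I+1) \<or> g ?c (3*I) \<and> g ?c (3*I+2) \<or> g ?c (3*I+1) \<and> g ?c (3*I+2)"
    using C[of "3*I" "3*I+1"] C[of "3*I" "3*I+2"] C[of "3*I+1" "3*I+2"] r by auto
  moreover have "g ?d (3*I) \<and> g ?d (3*I+1) \<or> g ?d (3*I) \<and> g ?d (3*I+2) \<or> g ?d (3*I+1) \<and> g ?d (3*I+2)"
    using D[of "3*I" "3*I+1"] D[of "3*I" "3*I+2"] D[of "3*I+1" "3*I+2"] r by auto
  ultimately show ?thesis using that r by blast
qed

text \<open>
  The two rectangles have at most two defects between them, and so one of the three disjoint windows
  starting at offsets 1, 6 and 11 avoids both.
\<close>

lemma clean_window:
  assumes G: "coarsen g T I" "coarsen g T I'"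
  obtains s where "1 \<le> s" "s \<le> 11"
    "\<And>c i. s \<le> c \<Longrightarrow> c < s + 5 \<Longrightarrow> i \<in> span_rows I \<union> span_rows I' \<Longrightarrow> g (17 * T + c) i"
proof -
  have bad: "\<exists>b. \<forall>c i. c < 17 \<longrightarrow> i \<in> span_rows J \<longrightarrow> c \<noteq> b \<longrightarrow> g (17 * T + c) i"
    if "coarsen g T J" for J
  proof (cases "\<exists>c<17. \<exists>i\<in>span_rows J. \<not> g (17 * T + c) i")
    case True
    then obtain b i where b: "b < 17" "i \<in> span_rows J" "\<not> g (17 * T + b) i" by blast
    have "g (17 * T + c) i'" if "c < 17" "i' \<in> span_rows J" "c \<noteq> b" for c i'
      by (rule coarsenD[OF \<open>coarsen g T J\<close> _ b(2,3)]) (use b that in \<open>auto simp: span_cols_def\<close>)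
    then show ?thesis by blast
  qed auto
  obtain b where b: "\<And>c i. c < 17 \<Longrightarrow> i \<in> span_rows I \<Longrightarrow> c \<noteq> b \<Longrightarrow> g (17 * T + c) i"
    using bad[OF G(1)] by blast
  obtain b' where b': "\<And>c i. c < 17 \<Longrightarrow> i \<in> span_rows I' \<Longrightarrow> c \<noteq> b' \<Longrightarrow> g (17 * T + c) i"
    using bad[OF G(2)] by blast
  have "\<exists>s\<in>{1, 6, 11}. \<not> (s \<le> b \<and> b < s + 5) \<and> \<not> (s \<le> b' \<and> b' < s + 5)"
    by (simp, presburger)
  then obtain s where s: "s \<in> {1, 6, 11}" "\<not> (s \<le> b \<and> b < s + 5)" "\<not> (s \<le> b' \<and> b' < s + 5)"
    by blast
  show ?thesis
  proof (rule that[of s])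
    fix c i assume "s \<le> c" "c < s + 5" "i \<in> span_rows I \<union> span_rows I'"
    moreover from this have "c < 17" "c \<noteq> b" "c \<noteq> b'" using s by auto
    ultimately show "g (17 * T + c) i" using b b' by blast
  qed (use s in auto)
qed

lemma staircase:
  fixes r r' :: int
  assumes "\<bar>r' - r\<bar> \<le> 5"
  obtains w :: "nat \<Rightarrow> int" where "\<And>c. c \<le> s \<Longrightarrow> w c = r" "\<And>c. s + 5 \<le> c \<Longrightarrow> w c = r'"
    "\<And>c. \<bar>w (Suc c) - w c\<bar> \<le> 1" "\<And>c. min r r' \<le> w c \<and> w c \<le> max r r'"
proof -
  define w where "w c = (if r \<le> r' then min r' (r + max 0 (int c - int s))
                          else max r' (r - max 0 (int c - int s)))" for c
  show ?thesis
    by (rule that[of w]; use assms in \<open>auto simp: w_def min_def max_def\<close>)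
qed

text \<open>
  Starting from \<open>e\<close>, the path moves at once to an intact row of its rectangle, waits for a window
  without defects, climbs there to an intact row of the target rectangle, and in the last column
  moves to a row \<open>e'\<close> that is good on both sides of the edge to the next column of rectangles. Two
  adjacent rectangles span 6 rows, which is why the climb takes at most 5 steps.
\<close>

lemma cross_coarse_column:
  assumes G: "coarsen g T I" "coarsen g T I'" "coarsen g (Suc T) I'" and II': "\<bar>I' - I\<bar> \<le> 1"
    and e: "e \<in> span_rows I" "g (17 * T) e"
  obtains w where "w 0 = e" "w 17 \<in> span_rows I'" "g (17 * T + 17) (w 17)"
    "\<And>c. c < 17 \<Longrightarrow> \<bar>w (Suc c) - w c\<bar> \<le> 1 \<and> g (17 * T + c) (w c) \<and> g (17 * T + c) (w (Suc c))"
proof -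
  obtain e' where e': "e' \<in> span_rows I'" "g (17 * T + 16) e'" "g (17 * T + 17) e'"
    using common_good_row[OF G(2,3)] .
  obtain r where r: "r \<in> span_rows I" "\<bar>r - e\<bar> \<le> 1" "\<And>c. c \<in> span_cols T \<Longrightarrow> g c r"
    using clean_row_nearby[OF G(1) e(1) _ e(2)] by (auto simp: span_cols_def)
  obtain r' where r': "r' \<in> span_rows I'" "\<bar>r' - e'\<bar> \<le> 1" "\<And>c. c \<in> span_cols T \<Longrightarrow> g c r'"
    using clean_row_nearby[OF G(2) e'(1) _ e'(2)] by (auto simp: span_cols_def)
  obtain s where s: "1 \<le> s" "s \<le> 11"
    "\<And>c i. s \<le> c \<Longrightarrow> c < s + 5 \<Longrightarrow> i \<in> span_rows I \<union> span_rows I' \<Longrightarrow> g (17 * T + c) i"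
    using clean_window[OF G(1,2)] by blast
  have rr': "\<bar>r' - r\<bar> \<le> 5" using r r' II' by (auto simp: span_rows_def)
  obtain v where v: "\<And>c. c \<le> s \<Longrightarrow> v c = r" "\<And>c. s + 5 \<le> c \<Longrightarrow> v c = r'"
    "\<And>c. \<bar>v (Suc c) - v c\<bar> \<le> 1" "\<And>c. min r r' \<le> v c \<and> v c \<le> max r r'"
    using staircase[OF rr', of s] by blast
  have vin: "v c \<in> span_rows I \<union> span_rows I'" for c
    using v(4)[of c] r(1) r'(1) II' by (auto simp: span_rows_def)
  have vg: "g (17 * T + c) (v c) \<and> g (17 * T + c) (v (Suc c))" if "c < 17" for c
  proof -
    have c: "17 * T + c \<in> span_cols T" using that by (simp add: span_cols_def)
    consider "c < s" | "s \<le> c" "c < s + 5" | "s + 5 \<le> c" by linarith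
    then show ?thesis
    proof cases
      case 1 then show ?thesis using v(1) r(3)[OF c] by simp
    next
      case 2 then show ?thesis using s(3) vin by blast
    next
      case 3 then show ?thesis using v(2) r'(3)[OF c] by simp
    qed
  qed
  define w where "w c = (if c = 0 then e else if c = 17 then e' else v c)" for c :: nat
  have "\<bar>w (Suc c) - w c\<bar> \<le> 1 \<and> g (17 * T + c) (w c) \<and> g (17 * T + c) (w (Suc c))" if c: "c < 17" for c
  proof -
    consider "c = 0" | "0 < c" "c < 16" | "c = 16" using c by linarith
    then show ?thesis
    proof cases
      case 1 then show ?thesis using e(2) r(2) v(1)[of 1] s(1) vg[of 0] by (auto simp: w_def)
    next
      case 2 then show ?thesis using v(3) vg[of c] by (auto simp: w_def)
    next
      case 3 then show ?thesis using e'(2) r'(2) v(2)[of 16] s(2) vg[of 16] by (auto simp: w_def)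
    qed
  qed
  then show ?thesis by (intro that[of w]) (auto simp: w_def e')
qed

text \<open>
  The initial row can be prescribed. This keeps the starting point fixed when the refinement is
  iterated through all scales.
\<close>

lemma refine_path:
  assumes "good_path (coarsen g) N U" and e: "e \<in> span_rows (U 0)" "g 0 e"
  obtains u where "good_path g (17 * N) u" "u 0 = e"
proof -
  have "\<exists>u. good_path g (17 * N) u \<and> u 0 = e \<and> u (17 * N) \<in> span_rows (U N)"
    using assms(1)
  proof (induction N)
    case 0
    then show ?case using e by (intro exI[of _ "\<lambda>_. e"]) (auto simp: good_path_def)
  next
    case (Suc N)
    have step: "\<bar>U (Suc N) - U N\<bar> \<le> 1" "coarsen g N (U N)" "coarsen g N (U (Suc N))"
        "coarsen g (Suc N) (U (Suc N))" and "good_path (coarsen g) N U"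
      using Suc.prems by (auto simp: good_path_def)
    then obtain u where u: "good_path g (17 * N) u" "u 0 = e" "u (17 * N) \<in> span_rows (U N)"
      using Suc.IH by blast
    have "g (17 * N) (u (17 * N))" using u(1) by (simp add: good_path_def)
    then obtain w where w: "w 0 = u (17 * N)" "w 17 \<in> span_rows (U (Suc N))"
      "g (17 * N + 17) (w 17)"
      "\<And>c. c < 17 \<Longrightarrow>
         \<bar>w (Suc c) - w c\<bar> \<le> 1 \<and> g (17 * N + c) (w c) \<and> g (17 * N + c) (w (Suc c))"
      using cross_coarse_column[OF step(2-4,1) u(3)] by blast
    define u' where "u' t = (if t \<le> 17 * N then u t else w (t - 17 * N))" for t
    have u'w: "u' (17 * N + c) = w c" for c
      using w(1) by (auto simp: u'_def)
    have "\<bar>u' (Suc t) - u' t\<bar> \<le> 1 \<and> g t (u' t) \<and> g t (u' (Suc t))" if t: "t < 17 * Suc N" for t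
    proof (cases "t < 17 * N")
      case True
      then show ?thesis using u(1) by (auto simp: good_path_def u'_def)
    next
      case False
      then show ?thesis
        using w(4)[of "t - 17 * N"] u'w[of "t - 17 * N"] u'w[of "Suc t - 17 * N"] t
        by (simp add: Suc_diff_le)
    qed
    moreover have "u' (17 * Suc N) = w 17" using u'w[of 17] by (simp add: add.commute)
    moreover have "u' 0 = e" using u(2) by (simp add: u'_def)
    ultimately show ?case using w(2,3)
      by (intro exI[of _ u']) (auto simp: good_path_def add.commute)
  qed
  then show ?thesis using that by blast
qed

text \<open>
  At scale \<open>k\<close> the constant row is a path of one step. Refining it \<open>k\<close> times multiplies its length by
  17 each time, and goodness of site \<open>(0, 0)\<close> at every scale allows each refinement to start in row 0.
\<close>

lemma multiscale_path:
  assumes "\<And>j. j \<le> k \<Longrightarrow> (coarsen ^^ j) g 0 0" and "(coarsen ^^ k) g 1 0"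
  obtains u where "good_path g (17 ^ k) u" "u 0 = 0"
proof -
  have "\<exists>u. good_path ((coarsen ^^ (k - j)) g) (17 ^ j) u \<and> u 0 = 0" if "j \<le> k" for j
    using that
  proof (induction j)
    case 0
    then show ?case using assms by (intro exI[of _ "\<lambda>_. 0"]) (auto simp: good_path_def)
  next
    case (Suc j)
    then obtain U where U: "good_path ((coarsen ^^ (k - j)) g) (17 ^ j) U" "U 0 = 0" by auto
    have "k - j = Suc (k - Suc j)" using Suc.prems by simp
    then have "good_path (coarsen ((coarsen ^^ (k - Suc j)) g)) (17 ^ j) U" using U(1) by simp
    then obtain u where "good_path ((coarsen ^^ (k - Suc j)) g) (17 * 17 ^ j) u" "u 0 = 0"
      by (rule refine_path[where e = 0]) (auto simp: U(2) span_rows_def intro: assms(1))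
    then show ?case by auto
  qed
  from this[of k] show ?thesis using that by auto
qed

section \<open>Percolation of links at density one half\<close>

text \<open>
  Sites of the finest grid are vertical blocks of 20 cells. The last cell of a block is not tried as
  a link because the cell above it belongs to the next block.
\<close>

definition block_good :: "config \<Rightarrow> nat \<Rightarrow> int \<Rightarrow> bool" where
  "block_good x t i \<longleftrightarrow> (\<exists>m\<in>{0..<19}. link x (int t, 20 * i + m))"

text \<open>
  Links in blocks whose rows differ by at most one are at most 38 cells apart in height, which
  is within the reach of the rule.
\<close>

lemma block_path_imp_chain:
  assumes u: "good_path (block_good x) N u"
  shows "t + n \<le> N \<Longrightarrow> m \<in> {0..<19} \<Longrightarrow> link x (int t, 20 * u t + m)
    \<Longrightarrow> chain link (Suc n) (int t, 20 * u t + m) x"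
proof (induction n arbitrary: t m)
  case 0
  then show ?case by auto
next
  case (Suc n)
  have step: "\<bar>u (Suc t) - u t\<bar> \<le> 1" using u Suc.prems(1) by (simp add: good_path_def)
  have "block_good x (Suc t) (u (Suc t))"
    using u Suc.prems(1) by (cases "Suc t = N") (auto simp: good_path_def)
  then obtain m' where m': "m' \<in> {0..<19}" "link x (int (Suc t), 20 * u (Suc t) + m')"
    unfolding block_good_def by blast
  have "chain link (Suc n) (int (Suc t), 20 * u (Suc t) + m') x"
    using Suc.prems(1) m' by (intro Suc.IH) auto
  moreover define j where "j = 20 * u (Suc t) + m' - (20 * u t + m)"
  moreover from this have "j \<in> {-40..40}" using step m'(1) Suc.prems(2) by auto
  ultimately have "\<exists>j\<in>{-40..40}. chain link (Suc n) ((int t, 20 * u t + m) + (1, j)) x"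
    by (intro bexI[of _ j]) (simp_all add: add.commute)
  then show ?case using Suc.prems(3) by (subst chain.simps) blast
qed

text \<open>
  The cells that site \<open>(t, i)\<close> of scale \<open>k\<close> stands for. Written with quotients, disjointness for
  different sites is immediate.
\<close>

definition block_cells :: "nat \<Rightarrow> nat \<Rightarrow> int \<Rightarrow> (int \<times> int) set" where
  "block_cells k t i = {(a, b). a div 17 ^ k = int t \<and> b div (20 * 3 ^ k) = i}"

lemma block_cells_disjoint:
  "(t, i) \<noteq> (t', i') \<Longrightarrow> block_cells k t i \<inter> block_cells k t' i' = {}"
  by (auto simp: block_cells_def)

lemma block_cells_Suc:
  assumes "c \<in> span_cols T" "i \<in> span_rows I"
  shows "block_cells k c i \<subseteq> block_cells (Suc k) T I"
proof -
  have "int c div 17 = int T" "i div 3 = I"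
    using assms by (auto simp: span_cols_def span_rows_def)
  moreover have "a div 17 ^ Suc k = (a div 17 ^ k) div 17"
    "b div (20 * 3 ^ Suc k) = (b div (20 * 3 ^ k)) div 3" for a b :: int
    using zdiv_zmult2_eq[of 17 a "17 ^ k"] zdiv_zmult2_eq[of 3 b "20 * 3 ^ k"]
    by (simp_all add: mult_ac)
  ultimately show ?thesis by (auto simp: block_cells_def)
qed

lemma coarsen_cong:
  assumes "\<And>c i. c \<in> span_cols T \<Longrightarrow> i \<in> span_rows I \<Longrightarrow> g c i = h c i"
  shows "coarsen g T I = coarsen h T I"
  unfolding coarsen_def using assms by simp

lemma block_determined:
  "determined_by {x. \<not> (coarsen ^^ k) (block_good x) t i} (block_cells k t i)"
proof -
  have "(coarsen ^^ k) (block_good x) t i = (coarsen ^^ k) (block_good y) t i"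
    if "\<forall>v\<in>block_cells k t i. x v = y v" for x y
    using that
  proof (induction k arbitrary: t i)
    case 0
    have "link x (int t, 20 * i + m) = link y (int t, 20 * i + m)" if "m \<in> {0..<19}" for m
    proof -
      have "(int t, 20 * i + m) \<in> block_cells 0 t i" "(int t, 20 * i + m + 1) \<in> block_cells 0 t i"
        using that by (auto simp: block_cells_def)
      then show ?thesis using 0 by (simp add: link_def)
    qed
    then show ?case by (simp add: block_good_def)
  next
    case (Suc k)
    show ?case
      unfolding funpow.simps o_apply
    proof (rule coarsen_cong)
      fix c j assume "c \<in> span_cols t" "j \<in> span_rows i"
      then have "\<forall>v\<in>block_cells k c j. x v = y v" using Suc.prems block_cells_Suc by blast
      then show "(coarsen ^^ k) (block_good x) c j = (coarsen ^^ k) (block_good y) c j"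
        by (rule Suc.IH)
    qed
  qed
  then show ?thesis by (auto simp: determined_by_def)
qed

lemma coarsen_measurable:
  assumes "\<And>c i. Measurable.pred M (\<lambda>x. g x c i)"
  shows "Measurable.pred M (\<lambda>x. coarsen (g x) T I)"
proof -
  have "finite (span_cols T)" "finite (span_rows I)" by (auto simp: span_cols_def span_rows_def)
  then show ?thesis
    unfolding coarsen_def by (intro pred_intros_finite pred_intros_logic assms) auto
qed

lemma block_measurable [measurable]:
  "Measurable.pred borel (\<lambda>x. (coarsen ^^ k) (block_good x) t i)"
proof (induction k arbitrary: t i)
  case 0
  show ?case unfolding funpow_0 block_good_def link_def by measurable
next
  case (Suc k)
  show ?case
    unfolding funpow.simps o_apply by (intro coarsen_measurable Suc.IH)
qed

lemma no_rise_imp_prefix: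
  fixes y :: "nat \<Rightarrow> bool"
  assumes "\<And>m. Suc m < n \<Longrightarrow> y (Suc m) \<Longrightarrow> y m"
  shows "\<exists>a\<le>n. \<forall>m<n. y m \<longleftrightarrow> m < a"
  using assms
proof (induction n)
  case (Suc n)
  then obtain a where a: "a \<le> n" "\<forall>m<n. y m \<longleftrightarrow> m < a" by force
  show ?case
  proof (cases "y n")
    case True
    have "a = n"
    proof (rule ccontr)
      assume "a \<noteq> n"
      then have n: "n = Suc (n - 1)" "\<not> y (n - 1)" using a by auto
      then show False using Suc.prems[of "n - 1"] True by auto
    qed
    then show ?thesis using a True by (intro exI[of _ "Suc n"]) (auto simp: less_Suc_eq)
  next
    case False
    then show ?thesis using a by (intro exI[of _ a]) (auto simp: less_Suc_eq)
  qed
qed simp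

abbreviation fair :: "config measure" where "fair \<equiv> bernoulli_measure (1 / 2)"

text \<open>
  Read upwards, a block without a link consists of ones followed by zeros, which leaves 21 of
  the \<open>2 ^ 20\<close> patterns.
\<close>

lemma measure_block_bad:
  "measure fair {x. \<not> block_good x t i} \<le> 21 / 2 ^ 20"
proof -
  interpret prob_space fair
    using bernoulli_measure_borel_probs by (auto simp: borel_probs_def)
  define cell where "cell m = (int t, 20 * i + int m)" for m
  define C where "C a = {x. \<forall>v\<in>cell ` {..<20}. x v = (v \<in> cell ` {..<a})}" for a :: nat
  have inj: "inj_on cell A" for A by (auto simp: inj_on_def cell_def)
  have meas: "C a \<in> sets borel" for a
    unfolding C_def by measurable
  have "{x. \<not> block_good x t i} \<subseteq> (\<Union>a\<le>20. C a)"
  proof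
    fix x assume x: "x \<in> {x. \<not> block_good x t i}"
    have "x (cell m)" if "Suc m < 20" "x (cell (Suc m))" for m
    proof -
      have "\<not> link x (int t, 20 * i + int m)" using x that(1) by (auto simp: block_good_def)
      then show ?thesis using that(2) by (auto simp: link_def cell_def ac_simps)
    qed
    then obtain a where "a \<le> 20" "\<forall>m<20. x (cell m) \<longleftrightarrow> m < a"
      using no_rise_imp_prefix[of 20 "\<lambda>m. x (cell m)"] by blast
    moreover have "cell m \<in> cell ` {..<a} \<longleftrightarrow> m < a" for m
      using inj_on_image_mem_iff[OF inj[of UNIV], of m "{..<a}"] by auto
    ultimately show "x \<in> (\<Union>a\<le>20. C a)" by (auto simp: C_def)
  qed
  then have "measure fair {x. \<not> block_good x t i} \<le> measure fair (\<Union>a\<le>20. C a)"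
    using meas by (intro finite_measure_mono) (auto simp: sets_bernoulli)
  also have "\<dots> \<le> (\<Sum>a\<le>20. measure fair (C a))"
    using meas by (intro measure_UNION_le) (auto simp: sets_bernoulli)
  also have "\<dots> = (\<Sum>a\<le>(20::nat). (1 / 2) ^ 20)"
  proof (rule sum.cong[OF refl])
    fix a
    have "pmf (bernoulli_pmf (1 / 2)) c = 1 / 2" for c by (cases c) auto
    then show "measure fair (C a) = (1 / 2) ^ 20"
      unfolding C_def by (subst bernoulli_cylinder) (simp_all add: card_image[OF inj])
  qed
  also have "\<dots> = 21 / 2 ^ 20" by (simp add: power_one_over)
  finally show ?thesis .
qed

text \<open>
  If \<open>q\<close> bounds the probability of a bad site, then \<open>51\<^sup>2 q\<^sup>2 = 2601 q\<^sup>2\<close> bounds it on the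
  coarser grid: a bad coarse site has two different bad sites among its 51, and these are independent.
  Hence \<open>2601 q\<close> is squared at every scale, starting below \<open>1/4\<close>.
\<close>

lemma measure_multiscale_bad:
  "2601 * measure fair {x. \<not> (coarsen ^^ k) (block_good x) t i} \<le> (1 / 4) ^ Suc k"
proof (induction k arbitrary: t i)
  case 0
  have "2601 * (21 / 2 ^ 20) \<le> (1 / 4 :: real)" by simp
  then show ?case using measure_block_bad[of t i] by simp
next
  case (Suc k)
  interpret prob_space fair
    using bernoulli_measure_borel_probs by (auto simp: borel_probs_def)
  let ?bad = "\<lambda>(c, j). {x. \<not> (coarsen ^^ k) (block_good x) c j}"
  let ?S = "span_cols t \<times> span_rows i"
  let ?Q = "{(s, s'). s \<in> ?S \<and> s' \<in> ?S \<and> s \<noteq> s'}"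
  have meas: "?bad s \<in> sets borel" for s by (cases s) auto
  have QS: "?Q \<subseteq> ?S \<times> ?S" and fin: "finite (?S \<times> ?S)"
    by (auto simp: span_cols_def span_rows_def)
  have Q: "finite ?Q" using finite_subset[OF QS fin] .
  have "card ?Q \<le> card (?S \<times> ?S)" using card_mono[OF fin QS] .
  also have "\<dots> = 2601" by (simp add: card_cartesian_product span_cols_def span_rows_def)
  finally have card_Q: "card ?Q \<le> 2601" .
  have "{x. \<not> (coarsen ^^ Suc k) (block_good x) t i} \<subseteq> (\<Union>(s, s')\<in>?Q. ?bad s \<inter> ?bad s')"
    by (fastforce simp: coarsen_def)
  then have "measure fair {x. \<not> (coarsen ^^ Suc k) (block_good x) t i}
      \<le> measure fair (\<Union>q\<in>?Q. ?bad (fst q) \<inter> ?bad (snd q))"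
    using meas Q by (intro finite_measure_mono) (auto simp: sets_bernoulli case_prod_unfold)
  also have "\<dots> \<le> (\<Sum>q\<in>?Q. measure fair (?bad (fst q) \<inter> ?bad (snd q)))"
    using meas Q by (intro measure_UNION_le) (auto simp: sets_bernoulli)
  also have "\<dots> \<le> (\<Sum>q\<in>?Q. ((1 / 4) ^ Suc k / 2601) ^ 2)"
  proof (rule sum_mono)
    fix q assume "q \<in> ?Q"
    then obtain c j c' j' where q: "q = ((c, j), (c', j'))" "(c, j) \<noteq> (c', j')" by fastforce
    have "measure fair (?bad (c, j) \<inter> ?bad (c', j')) = measure fair (?bad (c, j)) * measure fair (?bad (c', j'))"
      using meas[of "(c, j)"] meas[of "(c', j')"]
      by (intro bernoulli_independent[OF _ _ block_cells_disjoint[OF q(2), of k]])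
         (simp_all add: block_determined)
    also have "\<dots> \<le> ((1 / 4) ^ Suc k / 2601) * ((1 / 4) ^ Suc k / 2601)"
      using Suc.IH[of c j] Suc.IH[of c' j'] by (intro mult_mono) auto
    finally show "measure fair (?bad (fst q) \<inter> ?bad (snd q)) \<le> ((1 / 4) ^ Suc k / 2601) ^ 2"
      by (simp add: q(1) power2_eq_square)
  qed
  also have "\<dots> \<le> 2601 * ((1 / 4) ^ Suc k / 2601) ^ 2"
    using card_Q by (simp add: mult_right_mono)
  also have "\<dots> = ((1 / 4) ^ k / 4) * ((1 / 4) ^ Suc k / 2601)"
    by (simp add: power2_eq_square)
  also have "\<dots> \<le> (1 / 4) * ((1 / 4) ^ Suc k / 2601)"
    by (intro mult_right_mono) (simp_all add: power_le_one)
  finally show ?case by simp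
qed

text \<open>
  With probability at least \<open>1/2\<close> the sites on which the multiscale path depends are good at all scales
  up to \<open>n\<close>. The path then has length \<open>17 ^ n \<ge> n\<close> and provides a chain that keeps some
  cell of the starting block at 0 until time \<open>n\<close>.
\<close>

lemma measure_block_filled:
  "measure fair {x. \<forall>v\<in>Pair 0 ` {0..<20}. (link_rule ^^ n) x v} \<le> 1 / 2"
proof -
  interpret prob_space fair
    using bernoulli_measure_borel_probs by (auto simp: borel_probs_def)
  let ?bad = "\<lambda>k t. {x. \<not> (coarsen ^^ k) (block_good x) t 0}"
  have meas: "?bad k t \<in> sets borel" for k t by measurable
  have "{x. \<forall>v\<in>Pair 0 ` {0..<20}. (link_rule ^^ n) x v} \<subseteq> (\<Union>k\<le>n. ?bad k 0) \<union> ?bad n 1"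
  proof (rule ccontr)
    assume "\<not> ?thesis"
    then obtain x where filled: "\<forall>m\<in>{0..<20}. (link_rule ^^ n) x (0, m)"
      and good: "\<And>k. k \<le> n \<Longrightarrow> (coarsen ^^ k) (block_good x) 0 0"
        "(coarsen ^^ n) (block_good x) 1 0" by auto
    obtain u where u: "good_path (block_good x) (17 ^ n) u" "u 0 = 0"
      using multiscale_path[OF good] by blast
    obtain m where m: "m \<in> {0..<19}" "link x (0, m)"
      using good(1)[of 0] by (auto simp: block_good_def)
    have "chain link (Suc n) (0, m) x"
      using block_path_imp_chain[OF u(1), of 0 n m] m u(2) power_gt_expt[of 17 n] by simp
    then have "\<not> (link_rule ^^ n) x (0, m)" by (rule chain_imp_unfilled)
    then show False using filled m(1) by simp
  qed
  then have "measure fair {x. \<forall>v\<in>Pair 0 ` {0..<20}. (link_rule ^^ n) x v}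
      \<le> measure fair ((\<Union>k\<le>n. ?bad k 0) \<union> ?bad n 1)"
    using meas by (intro finite_measure_mono) (auto simp: sets_bernoulli)
  also have "\<dots> \<le> measure fair (\<Union>k\<le>n. ?bad k 0) + measure fair (?bad n 1)"
    using meas by (intro measure_Un_le) (auto simp: sets_bernoulli)
  also have "\<dots> \<le> (\<Sum>k\<le>n. measure fair (?bad k 0)) + measure fair (?bad n 1)"
    using meas by (intro add_right_mono measure_UNION_le) (auto simp: sets_bernoulli)
  also have "\<dots> \<le> (\<Sum>k\<le>n. (1 / 4) ^ Suc k / 2601) + (1 / 4) ^ Suc n / 2601"
    using measure_multiscale_bad by (intro add_mono sum_mono) (simp_all add: field_simps)
  also have "\<dots> \<le> 1 / 2"
  proof -
    have "(\<Sum>k\<le>n. (1 / 4) ^ Suc k / 2601) \<le> (1 - (1 / 4 :: real) ^ Suc n) / 2601"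
    proof (induction n)
      case (Suc n)
      have "(1 / 4) ^ Suc (Suc n) = (1 / 4) ^ Suc n / (4 :: real)" "0 \<le> (1 / 4 :: real) ^ Suc n"
        by simp_all
      then show ?case
        using Suc.IH unfolding sum.atMost_Suc diff_divide_distrib by linarith
    qed simp
    then show ?thesis unfolding diff_divide_distrib by linarith
  qed
  finally show ?thesis .
qed

section \<open>From fixed times to limit sets\<close>

lemma cylinder_borel: "finite V \<Longrightarrow> {x :: 'g \<Rightarrow> bool. \<forall>v\<in>V. x v = w v} \<in> sets borel"
  by measurable

lemma iterate_measurable:
  fixes f :: "('g::{ab_group_add,countable} \<Rightarrow> bool) \<Rightarrow> 'g \<Rightarrow> bool"
  assumes "cellular_automaton f"
  shows "f ^^ n \<in> borel_measurable borel"
proof -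
  have "continuous_on UNIV (f ^^ n)"
  proof (induction n)
    case 0
    show ?case by (simp add: id_def)
  next
    case (Suc n)
    then show ?case
      using continuous_on_compose continuous_on_subset cellular_automaton_continuous[OF assms]
      by (metis funpow.simps(2) subset_UNIV)
  qed
  then show ?thesis by (rule borel_measurable_continuous_onI)
qed

lemma measure_iterate:
  fixes f :: "('g::{ab_group_add,countable} \<Rightarrow> bool) \<Rightarrow> 'g \<Rightarrow> bool"
  assumes "cellular_automaton f" "C \<in> sets borel"
  shows "measure (distr (bernoulli_measure p) borel (f ^^ n)) C
           = measure (bernoulli_measure p) {x. (f ^^ n) x \<in> C}"
  using iterate_measurable[OF assms(1), of n] assms(2)
  by (subst measure_distr) (auto simp: space_bernoulli vimage_def cong: measurable_cong_sets[OF sets_bernoulli])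

lemma iterate_borel_probs:
  fixes f :: "('g::{ab_group_add,countable} \<Rightarrow> bool) \<Rightarrow> 'g \<Rightarrow> bool"
  assumes "cellular_automaton f"
  shows "distr (bernoulli_measure p) borel (f ^^ n) \<in> borel_probs"
proof -
  interpret prob_space "bernoulli_measure p :: ('g \<Rightarrow> bool) measure"
    using bernoulli_measure_borel_probs by (auto simp: borel_probs_def)
  show ?thesis
    using iterate_measurable[OF assms, of n] unfolding borel_probs_def
    by (auto intro!: prob_space_distr cong: measurable_cong_sets[OF sets_bernoulli])
qed

lemma limit_measureD:
  fixes m :: "nat \<Rightarrow> ('g \<Rightarrow> bool) measure"
  assumes "\<nu> \<in> limit_measures m" "\<And>n. m n \<in> borel_probs"
  obtains r where "strict_mono r" "\<nu> \<in> borel_probs"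
    "\<And>V w. finite V \<Longrightarrow> (\<lambda>n. measure (m (r n)) {x. \<forall>v\<in>V. x v = w v})
       \<longlonglongrightarrow> measure \<nu> {x. \<forall>v\<in>V. x v = w v}"
proof -
  obtain r where r: "strict_mono r" "limitin weak_star (m \<circ> r) \<nu> sequentially"
    using assms(1) unfolding limit_measures_def by blast
  have "\<nu> \<in> borel_probs" "\<forall>C\<in>cylinders. (\<lambda>n. measure ((m \<circ> r) n) C) \<longlonglongrightarrow> measure \<nu> C"
    using r(2) assms(2) by (subst (asm) limitin_weak_star; simp)+
  then show ?thesis using r(1) by (intro that[of r]) (auto simp: cylinders_def)
qed

lemma closed_singleton_config: "closed {w :: 'g \<Rightarrow> bool}"
proof -
  have "closed {w v}" for v
    unfolding closed_def by (rule discrete_topology_class.open_discrete)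
  then have "closed ((\<lambda>x. x v) -` {w v})" for v
    by (rule closed_vimage) (rule continuous_on_product_coordinates)
  moreover have "{w} = (\<Inter>v. (\<lambda>x. x v) -` {w v})" by (auto simp: fun_eq_iff)
  ultimately show ?thesis by auto
qed

lemma Supp_eq_singleton:
  fixes \<nu> :: "'x::second_countable_topology measure"
  assumes "\<nu> \<in> borel_probs" "closed {w}" "measure \<nu> {w} = 1"
  shows "Supp \<nu> = {w}"
proof -
  have "Supp \<nu> \<subseteq> {w}" using assms(2,3) unfolding Supp_def by (intro Inter_lower) auto
  moreover have "Supp \<nu> \<noteq> {}" using Supp_closed_full(2)[OF assms(1)] by auto
  ultimately show ?thesis by blast
qed

text \<open>
  The limit measures give every cell value 1 almost surely, so the point mass at the all-one
  configuration is the only candidate. It has to be shown to be a limit measure, as the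
  limit set would be empty otherwise.
\<close>

lemma trivializesI:
  fixes f :: "('g::{ab_group_add,countable} \<Rightarrow> bool) \<Rightarrow> 'g \<Rightarrow> bool"
  assumes f: "cellular_automaton f"
    and fills: "\<And>v. (\<lambda>n. measure (bernoulli_measure p) {x. \<not> (f ^^ n) x v}) \<longlonglongrightarrow> 0"
  shows "trivializes f (bernoulli_measure p)"
proof -
  let ?M = "bernoulli_measure p :: ('g \<Rightarrow> bool) measure"
  let ?m = "\<lambda>n. distr ?M borel (f ^^ n)"
  let ?ones = "\<lambda>_::'g. True"
  interpret prob_space ?M
    using bernoulli_measure_borel_probs by (auto simp: borel_probs_def)
  have m: "?m n \<in> borel_probs" for n by (rule iterate_borel_probs[OF f])
  have [measurable]: "Measurable.pred borel (\<lambda>x. (f ^^ n) x v)" for n v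
    using measurable_compose[OF iterate_measurable[OF f] cell_value_measurable] .
  have Supp: "Supp \<nu> = {?ones}" if lim: "\<nu> \<in> limit_measures ?m" for \<nu>
  proof -
    obtain r where r: "strict_mono r" "\<nu> \<in> borel_probs"
      "\<And>V w. finite V \<Longrightarrow> (\<lambda>n. measure (?m (r n)) {x. \<forall>v\<in>V. x v = w v})
         \<longlonglongrightarrow> measure \<nu> {x. \<forall>v\<in>V. x v = w v}"
      using limit_measureD[OF lim m] by blast
    interpret \<nu>: prob_space \<nu> using r(2) by (simp add: borel_probs_def)
    have s: "sets \<nu> = sets borel" using r(2) by (simp add: borel_probs_def)
    have sp: "space \<nu> = UNIV" using sets_eq_imp_space_eq[OF s] by simp
    have "measure \<nu> {x. \<not> x v} = 0" for v
    proof (rule LIMSEQ_unique)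
      show "(\<lambda>n. measure (?m (r n)) {x. \<not> x v}) \<longlonglongrightarrow> measure \<nu> {x. \<not> x v}"
        using r(3)[of "{v}" "\<lambda>_. False"] by simp
      show "(\<lambda>n. measure (?m (r n)) {x. \<not> x v}) \<longlonglongrightarrow> 0"
        using LIMSEQ_subseq_LIMSEQ[OF fills r(1), of v] by (simp add: measure_iterate[OF f] o_def)
    qed
    then have "AE x in \<nu>. x v" for v
      by (intro AE_I[of _ _ "{x. \<not> x v}"]) (auto simp: \<nu>.emeasure_eq_measure s)
    then have "AE x in \<nu>. x \<in> {?ones}"
      using AE_all_countable[of "\<lambda>v x. x v" \<nu>] by (auto simp: fun_eq_iff)
    then have "measure \<nu> {?ones} = 1" by (subst \<nu>.prob_eq_1) (auto simp: s intro: borel_closed closed_singleton_config)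
    then show ?thesis using Supp_eq_singleton[OF r(2) closed_singleton_config] by blast
  qed
  have "return borel ?ones \<in> limit_measures ?m"
  proof -
    have "(\<lambda>n. measure (?m n) C) \<longlonglongrightarrow> measure (return borel ?ones) C"
      if cyl: "C \<in> cylinders" for C
    proof -
      obtain V w where C: "finite V" "C = {x. \<forall>v\<in>V. x v = w v}"
        using cyl by (auto simp: cylinders_def)
      have Cb: "C \<in> sets borel" unfolding C(2) using C(1) by (rule cylinder_borel)
      have zero: "(\<lambda>n. measure ?M {x. (f ^^ n) x \<in> D}) \<longlonglongrightarrow> 0"
        if D: "D \<subseteq> (\<Union>v\<in>V. {x. \<not> x v})" for D
      proof (rule tendsto_sandwich[OF _ _ tendsto_const])
        show "(\<lambda>n. \<Sum>v\<in>V. measure ?M {x. \<not> (f ^^ n) x v}) \<longlonglongrightarrow> 0"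
          by (rule tendsto_null_sum) (rule fills)
        have "measure ?M {x. (f ^^ n) x \<in> D} \<le> (\<Sum>v\<in>V. measure ?M {x. \<not> (f ^^ n) x v})" for n
        proof -
          have "measure ?M {x. (f ^^ n) x \<in> D} \<le> measure ?M (\<Union>v\<in>V. {x. \<not> (f ^^ n) x v})"
            using D C(1) by (intro finite_measure_mono) (auto simp: sets_bernoulli)
          also have "\<dots> \<le> (\<Sum>v\<in>V. measure ?M {x. \<not> (f ^^ n) x v})"
            using C(1) by (intro measure_UNION_le) (auto simp: sets_bernoulli)
          finally show ?thesis .
        qed
        then show "\<forall>\<^sub>F n in sequentially. measure ?M {x. (f ^^ n) x \<in> D}
            \<le> (\<Sum>v\<in>V. measure ?M {x. \<not> (f ^^ n) x v})" by simp
      qed simp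
      show ?thesis
      proof (cases "\<forall>v\<in>V. w v")
        case True
        have "measure (?m n) C = 1 - measure ?M {x. (f ^^ n) x \<in> - C}" for n
        proof -
          have "{x. (f ^^ n) x \<in> C} \<in> sets ?M"
            using C(1) unfolding C(2) by (simp add: sets_bernoulli)
          then show ?thesis
            using prob_compl[of "{x. (f ^^ n) x \<in> C}"] 
            by (simp add: measure_iterate[OF f Cb] space_bernoulli Compl_eq_Diff_UNIV[symmetric] Collect_neg_eq)
        qed
        moreover have "(\<lambda>n. 1 - measure ?M {x. (f ^^ n) x \<in> - C}) \<longlonglongrightarrow> 1 - 0"
          using True C(2) by (intro tendsto_diff tendsto_const zero) auto
        moreover have "measure (return borel ?ones) C = 1"
          using True C(2) Cb by (simp add: measure_return)
        ultimately show ?thesis by simp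
      next
        case False
        then have "?ones \<notin> C" "C \<subseteq> (\<Union>v\<in>V. {x. \<not> x v})" using C(2) by auto
        then show ?thesis using zero[of C] Cb by (simp add: measure_iterate[OF f Cb] measure_return)
      qed
    qed
    moreover have "return borel ?ones \<in> borel_probs"
      by (simp add: borel_probs_def prob_space_return)
    ultimately have "limitin weak_star ?m (return borel ?ones) sequentially"
      by (subst limitin_weak_star[OF m]) blast
    then show ?thesis
      unfolding limit_measures_def by (auto intro!: exI[of _ id] simp: strict_mono_id)
  qed
  then have "(\<Union>\<nu>\<in>limit_measures ?m. Supp \<nu>) = {?ones}" using Supp by auto
  then show ?thesis by (simp add: trivializes_def mu_limit_set_def closure_closed[OF closed_singleton_config])
qed

text \<open>
  If the limit set were a single configuration \<open>w\<close>, some limit measure would be concentrated on \<open>w\<close>.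
  The bound \<open>c\<close> passes to the limit and yields a cell \<open>v\<close> of \<open>V\<close> at which \<open>w\<close> is 0. But cells that
  are 1 initially remain so, and hence the limit gives \<open>v\<close> value 1 with probability at least \<open>p\<close>.
\<close>

lemma not_trivializesI:
  fixes f :: "('g::{ab_group_add,countable} \<Rightarrow> bool) \<Rightarrow> 'g \<Rightarrow> bool"
  assumes f: "cellular_automaton f" "freezing f" and p: "0 < p" "p \<le> 1" and V: "finite V"
    and c: "c < 1" "\<And>n. measure (bernoulli_measure p) {x. \<forall>v\<in>V. (f ^^ n) x v} \<le> c"
  shows "\<not> trivializes f (bernoulli_measure p)"
proof
  let ?M = "bernoulli_measure p :: ('g \<Rightarrow> bool) measure"
  let ?m = "\<lambda>n. distr ?M borel (f ^^ n)"
  interpret prob_space ?M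
    using bernoulli_measure_borel_probs by (auto simp: borel_probs_def)
  have m: "?m n \<in> borel_probs" for n by (rule iterate_borel_probs[OF f(1)])
  have [measurable]: "Measurable.pred borel (\<lambda>x. (f ^^ n) x v)" for n v
    using measurable_compose[OF iterate_measurable[OF f(1)] cell_value_measurable] .
  assume "trivializes f ?M"
  then obtain w where w: "mu_limit_set f ?M = {w}"
    unfolding trivializes_def by (auto simp: card_1_singleton_iff)
  then have "(\<Union>\<nu>\<in>limit_measures ?m. Supp \<nu>) \<noteq> {}"
    unfolding mu_limit_set_def by (metis closure_empty insert_not_empty)
  then obtain \<nu> where \<nu>: "\<nu> \<in> limit_measures ?m" by blast
  then have "Supp \<nu> \<subseteq> {w}"
    using w closure_subset[of "\<Union>\<nu>\<in>limit_measures ?m. Supp \<nu>"] by (auto simp: mu_limit_set_def)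
  obtain r where "strict_mono r" and r: "\<nu> \<in> borel_probs"
    "\<And>V w. finite V \<Longrightarrow> (\<lambda>n. measure (?m (r n)) {x. \<forall>v\<in>V. x v = w v})
       \<longlonglongrightarrow> measure \<nu> {x. \<forall>v\<in>V. x v = w v}"
    using limit_measureD[OF \<nu> m] by blast
  interpret \<nu>: prob_space \<nu> using r(1) by (simp add: borel_probs_def)
  have s: "sets \<nu> = sets borel" using r(1) by (simp add: borel_probs_def)
  have full: "1 \<le> measure \<nu> A" if "w \<in> A" "A \<in> sets borel" for A
    using \<open>Supp \<nu> \<subseteq> {w}\<close> that s Supp_closed_full(2)[OF r(1)]
      \<nu>.finite_measure_mono[of "Supp \<nu>" A] by auto
  have "measure \<nu> {x. \<forall>v\<in>V. x v} \<le> c"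
  proof (rule tendsto_upperbound)
    show "(\<lambda>n. measure (?m (r n)) {x. \<forall>v\<in>V. x v}) \<longlonglongrightarrow> measure \<nu> {x. \<forall>v\<in>V. x v}"
      using r(2)[OF V, of "\<lambda>_. True"] by simp
    show "\<forall>\<^sub>F n in sequentially. measure (?m (r n)) {x. \<forall>v\<in>V. x v} \<le> c"
      using c(2) V by (simp add: measure_iterate[OF f(1)])
  qed simp
  moreover have "{x. \<forall>v\<in>V. x v} \<in> sets borel"
    using cylinder_borel[OF V, of "\<lambda>_. True"] by simp
  ultimately have "w \<notin> {x. \<forall>v\<in>V. x v}" using full[of "{x. \<forall>v\<in>V. x v}"] c(1) by linarith
  then obtain v where v: "\<not> w v" by blast
  have "measure \<nu> {x. \<not> x v} \<le> 1 - p"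
  proof (rule tendsto_upperbound)
    show "(\<lambda>n. measure (?m (r n)) {x. \<not> x v}) \<longlonglongrightarrow> measure \<nu> {x. \<not> x v}"
      using r(2)[of "{v}" "\<lambda>_. False"] by simp
    have keep: "x v \<Longrightarrow> (f ^^ n) x v" for x n
    proof (induction n)
      case (Suc n)
      then show ?case using f(2) by (auto simp: freezing_def le_fun_def)
    qed simp
    have "measure ?M {x. \<not> (f ^^ n) x v} \<le> measure ?M {x. x v = False}" for n
      using keep by (intro finite_measure_mono) (auto simp: sets_bernoulli)
    then show "\<forall>\<^sub>F n in sequentially. measure (?m (r n)) {x. \<not> x v} \<le> 1 - p"
      unfolding bernoulli_cell using p by (simp add: measure_iterate[OF f(1)])
  qed simp
  then show False using full[of "{x. \<not> x v}"] v p(1) by simp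
qed

section \<open>Trivialization at low and high density only\<close>

theorem theorem5p4:
  shows "\<exists>(f :: (int \<times> int \<Rightarrow> bool) \<Rightarrow> int \<times> int \<Rightarrow> bool) (\<epsilon>\<^sub>1 :: real) (\<epsilon>\<^sub>2 :: real) (\<epsilon>\<^sub>3 :: real).
           cellular_automaton f \<and> freezing f \<and>
           0 < \<epsilon>\<^sub>1 \<and> \<epsilon>\<^sub>1 < \<epsilon>\<^sub>2 \<and> \<epsilon>\<^sub>2 < \<epsilon>\<^sub>3 \<and> \<epsilon>\<^sub>3 < 1 \<and>
           trivializes f (bernoulli_measure \<epsilon>\<^sub>1) \<and>
           trivializes f (bernoulli_measure \<epsilon>\<^sub>3) \<and>
           \<not> trivializes f (bernoulli_measure \<epsilon>\<^sub>2)"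
proof (intro exI conjI)
  show "cellular_automaton link_rule" by (rule cellular_automaton_link_rule)
  show "freezing link_rule" by (rule freezing_link_rule)
  show "trivializes link_rule (bernoulli_measure (1 / 100))"
    "trivializes link_rule (bernoulli_measure (99 / 100))"
    by (auto intro!: trivializesI cellular_automaton_link_rule measure_unfilled_tendsto_0)
  show "\<not> trivializes link_rule (bernoulli_measure (1 / 2))"
    by (rule not_trivializesI[OF cellular_automaton_link_rule freezing_link_rule _ _ _ _ measure_block_filled]) auto
qed auto

end
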